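(* Let $p\neq 5$ be a prime and $n\ge1$. Suppose that $A\subseteq\mathbb{F}_p^n$ and that $A$ has no nontrivial solution to $$x_1+x_2+x_3+x_4+x_5=5y,$$ i.e. there are no $x_1,\dots,x_5,y\in A$ satisfying this equation with $x_i\neq y$ for some $i$. Then $$|A|\le p^n\exp\big(-c_p(\log p^n)^{1/5}\big)$$ for some positive constant $c_p$ depending only on $p$.
   Context: $\mathbb{F}_p^n$ is the $n$-dimensional vector space over the field with $p$ elements. Logarithms are to base $2$. *)

theory Defs
  imports Complex_Main "HOL-Library.Cardinality" "HOL-Computational_Algebra.Primes"
    "Jordan_Normal_Form.Matrix"
begin

text \<open>
  The field with \<open>p\<close> elements is any type \<open>'a :: field\<close> with \<open>CARD('a) = p\<close>, and the space
  of \<open>n\<close>-dimensional vectors over it is \<^term>\<open>carrier_vec n :: 'a::field vec set\<close>; thus \<open>n\<close> is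
  an ordinary number that can be quantified after the constant depending on \<open>p\<close>.
\<close>

definition nontrivial_solution ::
  "'a::field vec \<Rightarrow> 'a vec \<Rightarrow> 'a vec \<Rightarrow> 'a vec \<Rightarrow> 'a vec \<Rightarrow> 'a vec \<Rightarrow> bool" where
  "nontrivial_solution x1 x2 x3 x4 x5 y \<longleftrightarrow>
     x1 + x2 + x3 + x4 + x5 = 5 \<cdot>\<^sub>v y \<and>
     (x1 \<noteq> y \<or> x2 \<noteq> y \<or> x3 \<noteq> y \<or> x4 \<noteq> y \<or> x5 \<noteq> y)"

end

theory Submission
  imports Defs "HOL-Library.FuncSet"
begin

text \<open>
  Putting \<open>x\<^sub>1 = x\<^sub>2 = x\<^sub>3 = x\<^sub>4 = x\<close> shows that \<open>4x + z = 5y\<close> has only the solutions \<open>x = y = z\<close>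
  in \<open>A\<close>, so the slice rank method of Croot-Lev-Pach, Ellenberg-Gijswijt and Tao applies and even
  yields a bound exponential in \<open>n\<close>. By Fermat,
  \<open>T x y z = (\<Prod>i<n. 1 - (4x\<^sub>i + z\<^sub>i - 5y\<^sub>i)^(p - 1))\<close> is the indicator of \<open>4x + z = 5y\<close>, hence a
  diagonal tensor on \<open>A\<close>. Each monomial of \<open>T\<close> has degree at most \<open>n(p - 1)\<close>, thus degree at most
  \<open>n(p - 1)/3\<close> in one of \<open>x\<close>, \<open>y\<close>, \<open>z\<close>, and so \<open>card A\<close> is at most three times the number of reduced
  monomials of such a degree. These are exponentially rare by Chernoff's bound, because the average
  degree is \<open>n(p - 1)/2\<close>. For the finitely many \<open>n\<close> where this gives nothing, \<open>card A < p^n\<close> suffices.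
\<close>

section \<open>Linear systems over a finite field and the slice rank bound\<close>

text \<open>Pigeonhole: there are more coefficient vectors on \<open>S\<close> than value vectors on
  \<open>I\<close>, so two of them have the same values, and their difference is the
  solution.\<close>

lemma homogeneous_system_nontrivial_solution:
  fixes f :: "'i \<Rightarrow> 's \<Rightarrow> 'a::field"
  assumes "finite (UNIV :: 'a set)" "finite S" "finite I" "card I < card S"
  obtains v where "\<exists>s\<in>S. v s \<noteq> 0" "\<And>i. i \<in> I \<Longrightarrow> (\<Sum>s\<in>S. v s * f i s) = 0"
proof -
  let ?ev = "\<lambda>v. \<lambda>i\<in>I. \<Sum>s\<in>S. v s * f i s"
  let ?D = "S \<rightarrow>\<^sub>E (UNIV :: 'a set)" and ?R = "I \<rightarrow>\<^sub>E (UNIV :: 'a set)"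
  \<comment> \<open>The base of the two powers being compared is at least 2, so the larger exponent
    gives the strictly larger power.\<close>
  have "card {0, 1 :: 'a} \<le> card (UNIV :: 'a set)"
    using assms(1) by (intro card_mono) auto
  then have "card ?R < card ?D"
    using assms by (simp add: card_funcsetE)
  moreover have "finite ?R"
    using assms by (intro finite_PiE) auto
  moreover have "?ev ` ?D \<subseteq> ?R"
    by auto
  ultimately have "\<not> inj_on ?ev ?D"
    by (meson card_inj_on_le not_less)
  then obtain v w where vw: "v \<in> ?D" "w \<in> ?D" "v \<noteq> w" "?ev v = ?ev w"
    by (auto simp: inj_on_def)
  show ?thesis
  proof (rule that)
    show "\<exists>s\<in>S. v s - w s \<noteq> 0"
      using vw(1-3) by (metis PiE_ext eq_iff_diff_eq_0)
    show "(\<Sum>s\<in>S. (v s - w s) * f i s) = 0" if "i \<in> I" for i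
      using fun_cong[OF vw(4), of i] that by (simp add: left_diff_distrib sum_subtractf)
  qed
qed

text \<open>A solution of maximal support works: if more than \<open>card I\<close> points lay
  outside its support, a nonzero solution living on those points could be glued to it and enlarge
  the support.\<close>

lemma homogeneous_system_large_support:
  fixes f :: "'i \<Rightarrow> 's \<Rightarrow> 'a::field"
  assumes fin: "finite (UNIV :: 'a set)" "finite A" "finite I"
  obtains h where "\<And>i. i \<in> I \<Longrightarrow> (\<Sum>s\<in>A. h s * f i s) = 0"
    "card A \<le> card I + card {s \<in> A. h s \<noteq> 0}"
proof -
  define sol where "sol h \<longleftrightarrow> (\<forall>i\<in>I. (\<Sum>s\<in>A. h s * f i s) = 0)" for h
  define supp where "supp h = {s \<in> A. h s \<noteq> 0}" for h :: "'s \<Rightarrow> 'a"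
  have "sol (\<lambda>_. 0)"
    by (simp add: sol_def)
  moreover have "\<forall>h. sol h \<longrightarrow> card (supp h) < Suc (card A)"
    using fin(2) by (auto simp: supp_def less_Suc_eq_le intro!: card_mono)
  ultimately obtain h where h: "sol h" "\<And>g. sol g \<Longrightarrow> card (supp g) \<le> card (supp h)"
    using ex_has_greatest_nat[of sol "\<lambda>_. 0" "\<lambda>h. card (supp h)" "Suc (card A)"] by auto
  have "card A \<le> card I + card (supp h)"
  proof (rule ccontr)
    assume neg: "\<not> ?thesis"
    moreover have "card (A - supp h) = card A - card (supp h)"
      using fin(2) by (intro card_Diff_subset) (auto simp: supp_def)
    ultimately have "card I < card (A - supp h)"
      by linarith
    then obtain v where v: "\<exists>s\<in>A - supp h. v s \<noteq> 0"
      "\<And>i. i \<in> I \<Longrightarrow> (\<Sum>s\<in>A - supp h. v s * f i s) = 0"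
      using homogeneous_system_nontrivial_solution[of "A - supp h" I f] fin by blast
    define g where "g s = (if s \<in> supp h then h s else v s)" for s
    have "sol g"
      unfolding sol_def
    proof
      fix i assume i: "i \<in> I"
      have A: "A = supp h \<union> (A - supp h)" "finite (supp h)"
        using fin(2) by (auto simp: supp_def)
      have "(\<Sum>s\<in>A. g s * f i s) =
          (\<Sum>s\<in>supp h. g s * f i s) + (\<Sum>s\<in>A - supp h. g s * f i s)"
        using A fin(2) by (metis Diff_disjoint finite_Diff sum.union_disjoint)
      also have "(\<Sum>s\<in>supp h. g s * f i s) = (\<Sum>s\<in>A. h s * f i s)"
        using fin(2) by (intro sum.mono_neutral_cong_left) (auto simp: supp_def g_def)
      also have "(\<Sum>s\<in>A - supp h. g s * f i s) = (\<Sum>s\<in>A - supp h. v s * f i s)"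
        by (intro sum.cong) (auto simp: g_def)
      finally show "(\<Sum>s\<in>A. g s * f i s) = 0"
        using h(1) i v(2) by (simp add: sol_def)
    qed
    moreover have "supp h \<subset> supp g"
      using v(1) by (auto simp: supp_def g_def)
    then have "card (supp h) < card (supp g)"
      using fin(2) by (intro psubset_card_mono) (auto simp: supp_def)
    ultimately show False
      using h(2) by fastforce
  qed
  with h(1) show ?thesis
    using that by (auto simp: sol_def supp_def)
qed

text \<open>
  The slice rank bound for diagonal tensors: contracting \<open>T\<close> in its first variable with a vector that
  is orthogonal to all \<open>m e\<close> with \<open>e \<in> E\<close> and has large support leaves a diagonal matrix of large rank
  which, by the expansion, has rank at most \<open>2 * card E\<close>.
\<close>

lemma card_le_of_diagonal_expansion:
  fixes c :: "'t \<Rightarrow> 'a::field" and m :: "'e \<Rightarrow> 'v \<Rightarrow> 'a" and T :: "'v \<Rightarrow> 'v \<Rightarrow> 'v \<Rightarrow> 'a"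
  assumes fin: "finite (UNIV :: 'a set)" "finite A" "finite M" "finite E"
    and cover: "\<And>t. t \<in> M \<Longrightarrow> \<phi> t \<in> E \<or> \<psi> t \<in> E \<or> \<chi> t \<in> E"
    and T: "\<And>x y z. T x y z = (\<Sum>t\<in>M. c t * m (\<phi> t) x * m (\<psi> t) y * m (\<chi> t) z)"
    and diag: "\<And>x y z. x \<in> A \<Longrightarrow> y \<in> A \<Longrightarrow> z \<in> A \<Longrightarrow> T x y z \<noteq> 0 \<longleftrightarrow> x = z \<and> y = z"
  shows "card A \<le> 3 * card E"
proof (rule ccontr)
  assume neg: "\<not> ?thesis"
  obtain h where h: "\<And>e. e \<in> E \<Longrightarrow> (\<Sum>x\<in>A. h x * m e x) = 0"
    "card A \<le> card E + card {x \<in> A. h x \<noteq> 0}"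
    using homogeneous_system_large_support[of A E m] fin by blast
  define S where "S = {x \<in> A. h x \<noteq> 0}"
  define H where "H e = (\<Sum>x\<in>A. h x * m e x)" for e
  \<comment> \<open>After contraction with \<open>h\<close>, this is the coefficient of
    \<open>m e z\<close> in the expansion of the matrix in \<open>y\<close> and
    \<open>z\<close>.\<close>
  define q where "q e y = (\<Sum>t\<in>{t \<in> M. \<chi> t = e}. c t * H (\<phi> t) * m (\<psi> t) y)" for e y
  have S: "S \<subseteq> A" "finite S"
    using fin by (auto simp: S_def)
  \<comment> \<open>\<open>S\<close> has more than \<open>2 * card E\<close> points, so some nonzero
    \<open>v\<close> on \<open>S\<close> is orthogonal to all \<open>m e\<close> (left copy of
    \<open>E\<close>) and all \<open>q e\<close> (right copy).\<close>
  have "card (Sum_Type.Plus E E) < card S"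
    using neg h(2) fin by (simp add: S_def card_Plus)
  then obtain v where v: "\<exists>s\<in>S. v s \<noteq> 0"
    "\<And>i. i \<in> Sum_Type.Plus E E \<Longrightarrow> (\<Sum>s\<in>S. v s * case_sum m q i s) = 0"
    using homogeneous_system_nontrivial_solution[OF fin(1) S(2) finite_Plus[OF fin(4) fin(4)]]
    by metis
  define V where "V e = (\<Sum>y\<in>S. v y * m e y)" for e
  have V: "V e = 0" and vq: "(\<Sum>y\<in>S. v y * q e y) = 0" if "e \<in> E" for e
    using v(2)[of "Inl e"] v(2)[of "Inr e"] that by (auto simp: V_def)
  obtain s where s: "s \<in> S" "v s \<noteq> 0"
    using v(1) by blast
  \<comment> \<open>Column \<open>s\<close> of the contracted matrix has only its diagonal entry,
    which is nonzero as \<open>s\<close> lies in the support of \<open>h\<close>. Pairing the column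
    with \<open>v\<close> thus gives a nonzero value; the expansion will give 0.\<close>
  have "(\<Sum>x\<in>A. h x * T x y s) = (if y = s then h s * T s s s else 0)" if "y \<in> S" for y
  proof -
    have "(\<Sum>x\<in>A. h x * T x y s) = (\<Sum>x\<in>A. if x = s then h s * T s y s else 0)"
      using that s S diag[of _ y s] by (intro sum.cong) auto
    also have "\<dots> = h s * T s y s"
      using s S fin by (simp add: subset_iff)
    finally show ?thesis
      using that s S diag[of s y s] by auto
  qed
  then have "(\<Sum>y\<in>S. v y * (\<Sum>x\<in>A. h x * T x y s)) =
      (\<Sum>y\<in>S. if y = s then v s * (h s * T s s s) else 0)"
    by (intro sum.cong) auto
  also have "\<dots> = v s * (h s * T s s s)"
    using s S by simp
  finally have "(\<Sum>y\<in>S. v y * (\<Sum>x\<in>A. h x * T x y s)) \<noteq> 0"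
    using s S diag[of s s s] by (auto simp: S_def)
  moreover have "(\<Sum>y\<in>S. v y * (\<Sum>x\<in>A. h x * T x y s)) = 0"
  proof -
    have Hx: "(\<Sum>x\<in>A. h x * T x y s) = (\<Sum>t\<in>M. c t * H (\<phi> t) * m (\<psi> t) y * m (\<chi> t) s)" for y
      unfolding T H_def sum_distrib_left sum_distrib_right
      by (subst sum.swap) (simp add: mult_ac)
    have "(\<Sum>y\<in>S. v y * (\<Sum>x\<in>A. h x * T x y s)) =
        (\<Sum>t\<in>M. c t * H (\<phi> t) * V (\<psi> t) * m (\<chi> t) s)"
      unfolding Hx V_def sum_distrib_left sum_distrib_right
      by (subst sum.swap) (simp add: mult_ac)
    \<comment> \<open>If \<open>\<chi> t\<close> is not in \<open>E\<close>, then
      \<open>\<phi> t\<close> or \<open>\<psi> t\<close> is, and \<open>H\<close> or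
      \<open>V\<close> vanishes there. The remaining terms are grouped by \<open>\<chi> t\<close>,
      and orthogonality to \<open>q\<close> kills each group.\<close>
    also have "\<dots> = (\<Sum>t\<in>{t \<in> M. \<chi> t \<in> E}. c t * H (\<phi> t) * V (\<psi> t) * m (\<chi> t) s)"
      using fin cover h(1) V by (intro sum.mono_neutral_right) (auto simp: H_def)
    also have "\<dots> = (\<Sum>e\<in>E. \<Sum>t\<in>{t. t \<in> {t \<in> M. \<chi> t \<in> E} \<and> \<chi> t = e}.
        c t * H (\<phi> t) * V (\<psi> t) * m (\<chi> t) s)"
      using fin by (intro sum.group[symmetric]) auto
    also have "\<dots> = (\<Sum>e\<in>E. m e s * (\<Sum>y\<in>S. v y * q e y))"
    proof (intro sum.cong refl)
      fix e assume "e \<in> E"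
      then have eq: "{t. t \<in> {t \<in> M. \<chi> t \<in> E} \<and> \<chi> t = e} = {t \<in> M. \<chi> t = e}"
        by auto
      have "(\<Sum>t\<in>{t \<in> M. \<chi> t = e}. c t * H (\<phi> t) * V (\<psi> t) * m (\<chi> t) s) =
          (\<Sum>t\<in>{t \<in> M. \<chi> t = e}. c t * H (\<phi> t) * V (\<psi> t) * m e s)"
        by (intro sum.cong) auto
      also have "\<dots> = m e s * (\<Sum>y\<in>S. v y * q e y)"
        unfolding q_def V_def sum_distrib_left sum_distrib_right
        by (subst sum.swap) (simp add: mult_ac)
      finally show "(\<Sum>t\<in>{t. t \<in> {t \<in> M. \<chi> t \<in> E} \<and> \<chi> t = e}.
          c t * H (\<phi> t) * V (\<psi> t) * m (\<chi> t) s) = m e s * (\<Sum>y\<in>S. v y * q e y)"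
        unfolding eq .
    qed
    finally show ?thesis
      using vq by simp
  qed
  ultimately show False
    by contradiction
qed

section \<open>Monomial expansion of the indicator and the bound by low-degree monomials\<close>

lemma trinomial_ring:
  fixes x y z :: "'a::comm_ring_1"
  shows "(x + y + z) ^ k = (\<Sum>(i, j)\<in>(SIGMA i:{..k}. {..k - i}).
    of_nat (k choose i) * of_nat ((k - i) choose j) * x ^ i * y ^ j * z ^ (k - i - j))"
proof -
  have "(x + y + z) ^ k = (\<Sum>i\<le>k. of_nat (k choose i) * x ^ i * (y + z) ^ (k - i))"
    unfolding add.assoc by (rule binomial_ring)
  also have "\<dots> = (\<Sum>i\<le>k. \<Sum>j\<le>k - i.
      of_nat (k choose i) * of_nat ((k - i) choose j) * x ^ i * y ^ j * z ^ (k - i - j))"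
    unfolding binomial_ring[of y z] sum_distrib_left by (simp add: mult_ac)
  finally show ?thesis
    by (subst sum.Sigma[symmetric]) auto
qed

text \<open>This treats one coordinate of the indicator tensor. Only the bound on the total degree
  matters later, so the coefficients stay abstract.\<close>

lemma one_minus_linear_form_power_expansion:
  fixes \<alpha> \<beta> \<gamma> :: "'a::comm_ring_1"
  obtains K :: "(nat \<times> nat) option set" and c e f g where "finite K"
    "\<And>t. t \<in> K \<Longrightarrow> e t + f t + g t \<le> k"
    "\<And>x y z. 1 - (\<alpha> * x + \<beta> * y + \<gamma> * z) ^ k = (\<Sum>t\<in>K. c t * x ^ e t * y ^ f t * z ^ g t)"
proof -
  \<comment> \<open>The index \<open>None\<close> stands for the constant term \<open>1\<close>.\<close>
  define P where "P = (SIGMA i:{..k}. {..k - i})"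
  define K where "K = insert None (Some ` P)"
  define c where "c t = (case t of None \<Rightarrow> 1 | Some (i, j) \<Rightarrow>
    - (of_nat (k choose i) * of_nat ((k - i) choose j) * \<alpha> ^ i * \<beta> ^ j * \<gamma> ^ (k - i - j)))" for t
  define e f g :: "(nat \<times> nat) option \<Rightarrow> nat"
    where "e t = (case t of None \<Rightarrow> 0 | Some (i, j) \<Rightarrow> i)"
      and "f t = (case t of None \<Rightarrow> 0 | Some (i, j) \<Rightarrow> j)"
      and "g t = (case t of None \<Rightarrow> 0 | Some (i, j) \<Rightarrow> k - i - j)" for t
  show ?thesis
  proof (rule that)
    show "finite K"
      by (simp add: K_def P_def)
    show "e t + f t + g t \<le> k" if "t \<in> K" for t
      using that by (auto simp: K_def P_def e_def f_def g_def)
    show "1 - (\<alpha> * x + \<beta> * y + \<gamma> * z) ^ k = (\<Sum>t\<in>K. c t * x ^ e t * y ^ f t * z ^ g t)" for x y z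
    proof -
      have "(\<Sum>t\<in>K. c t * x ^ e t * y ^ f t * z ^ g t) =
          1 + (\<Sum>t\<in>P. c (Some t) * x ^ e (Some t) * y ^ f (Some t) * z ^ g (Some t))"
        unfolding K_def by (simp add: P_def sum.reindex c_def e_def f_def g_def)
      also have "(\<Sum>t\<in>P. c (Some t) * x ^ e (Some t) * y ^ f (Some t) * z ^ g (Some t)) =
          - ((\<alpha> * x + \<beta> * y + \<gamma> * z) ^ k)"
        unfolding trinomial_ring P_def[symmetric] sum_negf[symmetric]
        by (intro sum.cong refl)
          (auto simp: c_def e_def f_def g_def power_mult_distrib mult_ac)
      finally show ?thesis
        by simp
    qed
  qed
qed


text \<open>Multiplication by \<open>x\<close> permutes the nonzero elements, so it preserves their
  nonzero product.\<close>

lemma finite_field_power_card_minus_one: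
  fixes x :: "'a::field"
  assumes "finite (UNIV :: 'a set)" "x \<noteq> 0"
  shows "x ^ (CARD('a) - 1) = 1"
proof -
  have "(\<Prod>y\<in>UNIV - {0}. x * y) = \<Prod>(UNIV - {0})"
    by (rule prod.reindex_bij_witness[of _ "\<lambda>y. y / x" "\<lambda>y. x * y"]) (use assms in auto)
  moreover have "(\<Prod>y\<in>UNIV - {0}. x * y) = x ^ (CARD('a) - 1) * \<Prod>(UNIV - {0})"
    using assms(1) by (simp add: prod.distrib card_Diff_singleton)
  moreover have "\<Prod>(UNIV - {0 :: 'a}) \<noteq> 0"
    using assms(1) by simp
  ultimately show ?thesis
    by simp
qed

text \<open>\<open>sum0\<close> makes every constant triple a solution and \<open>nosol\<close>
  excludes all others in \<open>A\<close>: this is the diagonal pattern that the slice rank bound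
  requires.\<close>

lemma card_le_of_no_nontrivial_solution:
  fixes A :: "'a::field vec set" and \<alpha> \<beta> \<gamma> :: 'a
  assumes fin: "finite (UNIV :: 'a set)" "finite A"
    and sum0: "\<alpha> + \<beta> + \<gamma> = 0"
    and nosol: "\<And>x y z. x \<in> A \<Longrightarrow> y \<in> A \<Longrightarrow> z \<in> A \<Longrightarrow>
      (\<And>i. i < n \<Longrightarrow> \<alpha> * x $ i + \<beta> * y $ i + \<gamma> * z $ i = 0) \<Longrightarrow> x = z \<and> y = z"
  shows "card A \<le>
    3 * card {e \<in> {..<n} \<rightarrow>\<^sub>E {..<CARD('a)}. 3 * sum e {..<n} \<le> n * (CARD('a) - 1)}"
proof -
  define k where "k = CARD('a) - 1"
  have "CARD('a) > 0"
    using fin(1) by (simp add: card_gt_0_iff)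
  then have less_iff: "d < CARD('a) \<longleftrightarrow> d \<le> k" for d
    by (auto simp: k_def)
  \<comment> \<open>A positive \<open>k\<close> ensures \<open>0 ^ k = 0\<close>, so each factor of
    \<open>T\<close> equals 1 on the diagonal.\<close>
  have "card {0, 1 :: 'a} \<le> CARD('a)"
    using fin(1) by (intro card_mono) auto
  then have "k > 0"
    by (simp add: k_def)
  obtain K :: "(nat \<times> nat) option set" and c e f g where K: "finite K"
    "\<And>t. t \<in> K \<Longrightarrow> e t + f t + g t \<le> k"
    "\<And>x y z. 1 - (\<alpha> * x + \<beta> * y + \<gamma> * z) ^ k = (\<Sum>t\<in>K. c t * x ^ e t * y ^ f t * z ^ g t)"
    by (rule one_minus_linear_form_power_expansion[of k \<alpha> \<beta> \<gamma>]) (rule that)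
  define E where "E = {e \<in> {..<n} \<rightarrow>\<^sub>E {..<CARD('a)}. 3 * sum e {..<n} \<le> n * k}"
  define m :: "(nat \<Rightarrow> nat) \<Rightarrow> 'a vec \<Rightarrow> 'a" where "m d x = (\<Prod>i<n. x $ i ^ d i)" for d x
  define T where "T x y z = (\<Prod>i<n. 1 - (\<alpha> * x $ i + \<beta> * y $ i + \<gamma> * z $ i) ^ k)" for x y z
  \<comment> \<open>Expanding the product over coordinates means choosing a term of \<open>K\<close>
    for each coordinate; \<open>?ex\<close> then reads off the exponent vector of one
    variable.\<close>
  let ?M = "{..<n} \<rightarrow>\<^sub>E K"
  let ?ex = "\<lambda>d t. \<lambda>i\<in>{..<n}. d (t i)"
  have "card A \<le> 3 * card E"
  proof (rule card_le_of_diagonal_expansion)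
    show "finite ?M"
      using K(1) by (intro finite_PiE) auto
    show "finite E"
      unfolding E_def by (intro finite_subset[OF _ finite_PiE[of "{..<n}" "\<lambda>_. {..<CARD('a)}"]]) auto
    show "?ex e t \<in> E \<or> ?ex f t \<in> E \<or> ?ex g t \<in> E" if t: "t \<in> ?M" for t
    proof -
      have le: "e (t i) + f (t i) + g (t i) \<le> k" if "i < n" for i
        using t that by (intro K(2)) auto
      have "(\<Sum>i<n. e (t i) + f (t i) + g (t i)) \<le> (\<Sum>i<n. k)"
        using le by (intro sum_mono) auto
      then have "(\<Sum>i<n. e (t i)) + (\<Sum>i<n. f (t i)) + (\<Sum>i<n. g (t i)) \<le> n * k"
        by (simp add: sum.distrib)
      then have "3 * (\<Sum>i<n. e (t i)) \<le> n * k \<or> 3 * (\<Sum>i<n. f (t i)) \<le> n * k \<or>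
          3 * (\<Sum>i<n. g (t i)) \<le> n * k"
        by linarith
      moreover have "?ex e t \<in> {..<n} \<rightarrow>\<^sub>E {..<CARD('a)}" "?ex f t \<in> {..<n} \<rightarrow>\<^sub>E {..<CARD('a)}"
        "?ex g t \<in> {..<n} \<rightarrow>\<^sub>E {..<CARD('a)}"
        using le by (force simp: less_iff)+
      ultimately show ?thesis
        by (simp add: E_def)
    qed
    show "T x y z = (\<Sum>t\<in>?M. (\<Prod>i<n. c (t i)) * m (?ex e t) x * m (?ex f t) y * m (?ex g t) z)"
      for x y z
      unfolding T_def K(3) using K(1)
      by (subst prod_sum_PiE) (auto simp: m_def prod.distrib)
    show "T x y z \<noteq> 0 \<longleftrightarrow> x = z \<and> y = z" if "x \<in> A" "y \<in> A" "z \<in> A" for x y z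
    proof
      assume T: "T x y z \<noteq> 0"
      have "\<alpha> * x $ i + \<beta> * y $ i + \<gamma> * z $ i = 0" if "i < n" for i
        using T that finite_field_power_card_minus_one[OF fin(1)]
        by (auto simp: T_def k_def)
      then show "x = z \<and> y = z"
        using nosol that by blast
    next
      assume "x = z \<and> y = z"
      moreover have "\<alpha> * s + \<beta> * s + \<gamma> * s = 0" for s
        using sum0 by (metis distrib_right mult_zero_left)
      ultimately show "T x y z \<noteq> 0"
        using \<open>k > 0\<close> by (simp add: T_def zero_power)
    qed
  qed (use fin in auto)
  then show ?thesis
    by (simp add: E_def k_def)
qed

section \<open>Counting estimates: rarity of low degrees and the resulting decay\<close>

lemma card_low_degree_exponents_le:
  fixes p :: nat
  assumes "p \<ge> 2"
  obtains \<theta> :: real where "0 < \<theta>" "\<theta> < 1"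
    "\<And>n. real (card {e \<in> {..<n} \<rightarrow>\<^sub>E {..<p}. 3 * sum e {..<n} \<le> n * (p - 1)}) \<le> (real p * \<theta>) ^ n"
proof -
  \<comment> \<open>Chernoff's bound with parameter \<open>s < 1\<close> close to \<open>1\<close>: \<open>G\<close> vanishes at \<open>1\<close> and increases there.\<close>
  define G where "G s = (\<Sum>i<p. s ^ (3 * i)) - real p * s ^ (p - 1)" for s :: real
  have "(G has_real_derivative (\<Sum>i<p. real (3 * i)) - real p * real (p - 1)) (at 1)"
    unfolding G_def by (auto intro!: derivative_eq_intros)
  moreover have "(\<Sum>i<p. real (3 * i)) - real p * real (p - 1) = real p * (real p - 1) / 2"
  proof -
    have "(\<Sum>i<q. real (3 * i)) = 3 * real q * (real q - 1) / 2" for q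
      by (induction q) (auto simp: field_simps)
    then show ?thesis
      using assms by (simp add: field_simps of_nat_diff)
  qed
  moreover have "real p * (real p - 1) / 2 > 0"
    using assms by simp
  ultimately obtain d where d: "d > 0" "\<And>h. h > 0 \<Longrightarrow> h < d \<Longrightarrow> G (1 - h) < G 1"
    by (metis DERIV_pos_inc_left)
  define s where "s = 1 - min (d / 2) (1 / 2)"
  have s: "0 < s" "s < 1"
    using d(1) by (auto simp: s_def)
  have "G s < G 1"
    unfolding s_def using d(1) by (intro d(2)) (auto simp: min_def)
  then have lt: "(\<Sum>i<p. s ^ (3 * i)) < real p * s ^ (p - 1)"
    by (simp add: G_def)
  \<comment> \<open>The Chernoff factor contributed by one coordinate; \<open>G s < G 1 = 0\<close>
    says that it is below 1.\<close>
  define \<theta> where "\<theta> = (\<Sum>i<p. s ^ (3 * i)) / (real p * s ^ (p - 1))"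
  have pos: "(\<Sum>i<p. s ^ (3 * i)) > 0"
    using s assms by (intro sum_pos) (auto simp: lessThan_empty_iff)
  show ?thesis
  proof (rule that)
    show "0 < \<theta>" "\<theta> < 1"
      using pos lt s assms by (auto simp: \<theta>_def)
    fix n
    define E where "E = {e \<in> {..<n} \<rightarrow>\<^sub>E {..<p}. 3 * sum e {..<n} \<le> n * (p - 1)}"
    have fin: "finite ({..<n} \<rightarrow>\<^sub>E {..<p})"
      by (intro finite_PiE) auto
    have "real (card E) * s ^ (n * (p - 1)) = (\<Sum>e\<in>E. s ^ (n * (p - 1)))"
      by simp
    \<comment> \<open>As \<open>s < 1\<close>, the degree bound defining \<open>E\<close> reverses
      into a bound on powers. The sum is then extended to all exponent vectors, where it factors
      over the coordinates.\<close>
    also have "\<dots> \<le> (\<Sum>e\<in>E. s ^ (3 * sum e {..<n}))"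
      using s by (intro sum_mono power_decreasing) (auto simp: E_def)
    also have "\<dots> \<le> (\<Sum>e\<in>{..<n} \<rightarrow>\<^sub>E {..<p}. s ^ (3 * sum e {..<n}))"
      using s fin by (intro sum_mono2) (auto simp: E_def)
    also have "\<dots> = (\<Sum>i<p. s ^ (3 * i)) ^ n"
      using prod_sum_PiE[of "{..<n}" "\<lambda>_. {..<p}" "\<lambda>_ i. s ^ (3 * i)"]
      by (simp add: power_sum sum_distrib_left)
    also have "\<dots> = (real p * \<theta>) ^ n * s ^ (n * (p - 1))"
      using s assms by (simp add: \<theta>_def power_mult power_divide power_mult_distrib
        flip: power_mult mult.commute[of n])
    finally show "real (card E) \<le> (real p * \<theta>) ^ n"
      using s by (simp add: mult_le_cancel_right)
  qed
qed

lemma card_carrier_vec_eq: "card (carrier_vec n :: 'a vec set) = CARD('a) ^ n"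
proof -
  have "bij_betw (\<lambda>v. \<lambda>i\<in>{..<n}. v $ i) (carrier_vec n :: 'a vec set) ({..<n} \<rightarrow>\<^sub>E UNIV)"
    by (rule bij_betw_byWitness[where f' = "vec n"])
      (auto simp: restrict_def fun_eq_iff PiE_def extensional_def)
  then show ?thesis
    by (simp add: bij_betw_same_card card_funcsetE)
qed

lemma exp_decay_of_bounds:
  fixes \<theta> :: real and p :: nat
  assumes "p \<ge> 2" "0 < \<theta>" "\<theta> < 1"
  obtains c :: real where "c > 0"
    "\<And>n N. n \<ge> 1 \<Longrightarrow> real N \<le> 3 * (real p * \<theta>) ^ n \<Longrightarrow> N < p ^ n \<Longrightarrow>
      real N \<le> real p ^ n * exp (- c * real n)"
proof -
  define L where "L = - ln \<theta>"
  have L: "L > 0" "\<theta> = exp (- L)"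
    using assms by (auto simp: L_def)
  \<comment> \<open>From \<open>m\<close> on, the factor 3 costs at most half of the exponent
    \<open>L * n\<close>. The second argument of the minimum in \<open>c\<close> serves the finitely
    many smaller \<open>n\<close>.\<close>
  obtain m :: nat where m: "real m > 2 * ln 3 / L"
    using reals_Archimedean2 by blast
  define c where "c = min (L / 2) (1 / (real p ^ m * (real m + 1)))"
  show ?thesis
  proof (rule that)
    show "c > 0"
      using L assms by (simp add: c_def add_pos_pos)
    fix n N :: nat
    assume n: "n \<ge> 1" and N: "real N \<le> 3 * (real p * \<theta>) ^ n" "N < p ^ n"
    show "real N \<le> real p ^ n * exp (- c * real n)"
    proof (cases "n \<ge> m")
      case True
      have "2 * ln 3 \<le> real n * L"
      proof -
        have "2 * ln 3 < real m * L"
          using m L(1) by (simp add: field_simps)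
        also have "\<dots> \<le> real n * L"
          using True L(1) by (intro mult_right_mono) auto
        finally show ?thesis
          by simp
      qed
      have "3 * \<theta> ^ n = exp (ln 3 - L * real n)"
        by (simp add: L(2) exp_diff exp_minus exp_of_nat_mult power_inverse field_simps
          flip: exp_of_nat_mult)
      also have "\<dots> \<le> exp (- (L / 2) * real n)"
        using \<open>2 * ln 3 \<le> real n * L\<close> by (simp add: field_simps)
      also have "\<dots> \<le> exp (- c * real n)"
        unfolding exp_le_cancel_iff by (intro mult_right_mono) (auto simp: c_def)
      finally have "real p ^ n * (3 * \<theta> ^ n) \<le> real p ^ n * exp (- c * real n)"
        by (intro mult_left_mono) auto
      then show ?thesis
        using N(1) by (simp add: power_mult_distrib mult_ac)
    next
      case False
      \<comment> \<open>Integrality turns \<open>N < p ^ n\<close> into a saving of the factor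
        \<open>1 - 1 / p ^ n\<close>, which is at most \<open>exp (- 1 / p ^ n)\<close>.\<close>
      have "real (N + 1) \<le> real (p ^ n)"
        using N(2) by (intro of_nat_mono) simp
      then have "real N \<le> real p ^ n * (1 - 1 / real p ^ n)"
        using assms by (simp add: right_diff_distrib)
      also have "\<dots> \<le> real p ^ n * exp (- (1 / real p ^ n))"
        using exp_ge_add_one_self[of "- (1 / real p ^ n)"] by (intro mult_left_mono) auto
      also have "\<dots> \<le> real p ^ n * exp (- c * real n)"
      proof -
        have "c * real n \<le> 1 / (real p ^ m * (real m + 1)) * (real m + 1)"
          using False by (intro mult_mono) (auto simp: c_def)
        also have "\<dots> = 1 / real p ^ m"
          by (simp add: add_eq_0_iff)
        also have "\<dots> \<le> 1 / real p ^ n"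
          using False assms by (intro divide_left_mono power_increasing) auto
        finally show ?thesis
          by (intro mult_left_mono) auto
      qed
      finally show ?thesis .
    qed
  qed
qed

section \<open>From the five-variable equation to three variables, and the final bound\<close>

theorem theorem4:
  fixes p :: nat
  assumes "prime p" and "p \<noteq> 5" and "CARD('a::field) = p"
  shows "\<exists>c::real. c > 0 \<and>
    (\<forall>n::nat. n \<ge> 1 \<longrightarrow> (\<forall>A :: 'a vec set.
      A \<subseteq> carrier_vec n \<longrightarrow>
      \<not> (\<exists>x1\<in>A. \<exists>x2\<in>A. \<exists>x3\<in>A. \<exists>x4\<in>A. \<exists>x5\<in>A. \<exists>y\<in>A. nontrivial_solution x1 x2 x3 x4 x5 y) \<longrightarrow>
      real (card A) \<le> real p ^ n * exp (- c * (log 2 (real p ^ n)) powr (1 / 5))))"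
proof -
  have p: "p \<ge> 2"
    using assms(1) by (rule prime_ge_2_nat)
  have finU: "finite (UNIV :: 'a set)"
    using p assms(3) by (metis card.infinite not_numeral_le_zero)
  obtain \<theta> :: real where \<theta>: "0 < \<theta>" "\<theta> < 1"
    "\<And>n. real (card {e \<in> {..<n} \<rightarrow>\<^sub>E {..<p}. 3 * sum e {..<n} \<le> n * (p - 1)}) \<le> (real p * \<theta>) ^ n"
    using card_low_degree_exponents_le[OF p] by blast
  obtain c :: real where c: "c > 0"
    "\<And>n N. n \<ge> 1 \<Longrightarrow> real N \<le> 3 * (real p * \<theta>) ^ n \<Longrightarrow> N < p ^ n \<Longrightarrow>
      real N \<le> real p ^ n * exp (- c * real n)"
    using exp_decay_of_bounds[OF p \<theta>(1,2)] by blast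
  have lp: "log 2 (real p) \<ge> 1"
    using p by (simp add: le_log_iff)
  show ?thesis
  \<comment> \<open>Dividing by \<open>log 2 p\<close> rewrites \<open>c * n\<close> as a multiple
    of \<open>log 2 (p ^ n)\<close>. This logarithm is at least 1, so its power \<open>1 / 5\<close>
    does not exceed it.\<close>
  proof (intro exI[of _ "c / log 2 (real p)"] conjI allI impI)
    show "c / log 2 (real p) > 0"
      using c(1) lp by simp
    fix n :: nat and A :: "'a vec set"
    assume n: "n \<ge> 1" and A: "A \<subseteq> carrier_vec n"
      and "\<not> (\<exists>x1\<in>A. \<exists>x2\<in>A. \<exists>x3\<in>A. \<exists>x4\<in>A. \<exists>x5\<in>A. \<exists>y\<in>A. nontrivial_solution x1 x2 x3 x4 x5 y)"
    then have nosol: "x = y \<and> z = y"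
      if "x \<in> A" "y \<in> A" "z \<in> A" "x + x + x + x + z = 5 \<cdot>\<^sub>v y" for x y z
      using that unfolding nontrivial_solution_def by blast
    have card_carrier: "card (carrier_vec n :: 'a vec set) = p ^ n"
      by (simp add: card_carrier_vec_eq assms(3))
    then have fin_carrier: "finite (carrier_vec n :: 'a vec set)"
      using p by (intro card_ge_0_finite) simp
    have "card A \<le> 3 * card {e \<in> {..<n} \<rightarrow>\<^sub>E {..<CARD('a)}. 3 * sum e {..<n} \<le> n * (CARD('a) - 1)}"
    proof (rule card_le_of_no_nontrivial_solution)
      show "finite A"
        using A fin_carrier by (rule finite_subset)
      show "4 + 1 + (- 5) = (0 :: 'a)"
        by simp
      fix x z y :: "'a vec"
      assume xyz: "x \<in> A" "z \<in> A" "y \<in> A"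
        and eq: "\<And>i. i < n \<Longrightarrow> 4 * x $ i + 1 * z $ i + (- 5) * y $ i = 0"
      have carr: "x \<in> carrier_vec n" "y \<in> carrier_vec n" "z \<in> carrier_vec n"
        using xyz A by auto
      have "x + x + x + x + z = 5 \<cdot>\<^sub>v y"
      proof (rule eq_vecI)
        fix i assume "i < dim_vec (5 \<cdot>\<^sub>v y)"
        then show "(x + x + x + x + z) $ i = (5 \<cdot>\<^sub>v y) $ i"
          using carr eq[of i] by (auto simp: algebra_simps)
      qed (use carr in auto)
      then show "x = y \<and> z = y"
        using nosol xyz by blast
    qed (rule finU)
    then have "real (card A) \<le> 3 * (real p * \<theta>) ^ n"
      using \<theta>(3)[of n] unfolding assms(3) by linarith
    \<comment> \<open>With \<open>u\<close> the first unit vector, nonzero as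
      \<open>n \<ge> 1\<close>, the whole space contains the nontrivial solution
      \<open>u + u + u + u + (-4) u = 5 * 0\<close>.\<close>
    moreover have "A \<noteq> carrier_vec n"
    proof
      assume "A = carrier_vec n"
      moreover have "unit_vec n 0 + unit_vec n 0 + unit_vec n 0 + unit_vec n 0 +
          (- 4) \<cdot>\<^sub>v unit_vec n 0 = 5 \<cdot>\<^sub>v (0\<^sub>v n :: 'a vec)"
        by (rule eq_vecI) auto
      ultimately have "unit_vec n 0 = (0\<^sub>v n :: 'a vec)"
        using nosol[of "unit_vec n 0" "0\<^sub>v n" "(- 4) \<cdot>\<^sub>v unit_vec n 0"] by simp
      then have "unit_vec n 0 $ 0 = (0\<^sub>v n :: 'a vec) $ 0"
        by simp
      then show False
        using n by simp
    qed
    then have "card A < p ^ n"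
      using A fin_carrier card_carrier by (metis psubset_card_mono psubsetI)
    ultimately have "real (card A) \<le> real p ^ n * exp (- c * real n)"
      using c(2) n by blast
    also have "\<dots> \<le> real p ^ n * exp (- (c / log 2 (real p)) * (log 2 (real p ^ n)) powr (1 / 5))"
    proof -
      have eq: "log 2 (real p ^ n) = real n * log 2 (real p)"
        using p by (simp add: log_nat_power)
      have "1 * 1 \<le> real n * log 2 (real p)"
        using n lp by (intro mult_mono) auto
      then have "(real n * log 2 (real p)) powr (1 / 5) \<le> (real n * log 2 (real p)) powr 1"
        by (intro powr_mono) auto
      then have "c / log 2 (real p) * (real n * log 2 (real p)) powr (1 / 5) \<le>
          c / log 2 (real p) * (real n * log 2 (real p))"
        using c(1) lp by (intro mult_left_mono) (auto simp: powr_one)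
      also have "\<dots> = c * real n"
        using lp by auto
      finally show ?thesis
        unfolding eq by (intro mult_left_mono) auto
    qed
    finally show "real (card A) \<le>
        real p ^ n * exp (- (c / log 2 (real p)) * (log 2 (real p ^ n)) powr (1 / 5))" .
  qed
qed

end
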